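(* Let $(D_\lambda)_{\lambda\in\Lambda}$ be a family of commutative rings and $R=\prod_{\lambda\in\Lambda}D_\lambda$. Then the following are equivalent: (a) $(\mathcal{U})$ is a maximal ideal of $R$ for every ultrafilter $\mathcal{U}$ in $\mathcal{B}=\prod_{\lambda\in\Lambda}\mathcal{P}(\max(D_\lambda))$. (b) The subspace $\max(D_\lambda)$ is proconstructible in $\operatorname{spec}(D_\lambda)$ for every $\lambda\in\Lambda$. (c) For every $\lambda\in\Lambda$ and every $r\in D_\lambda$ there exists $d\in D_\lambda$ such that $\mathscr{D}(r)=\mathscr{V}(d)$.
   Context: Rings are commutative with identity. For a ring $D$, $\operatorname{spec}(D)$ is the set of prime ideals, $\max(D)$ the set of maximal ideals, and for $a\in D$, $\mathscr{V}(a)=\{M\in\max(D)\mid a\in M\}$ and $\mathscr{D}(a)=\max(D)\setminus\mathscr{V}(a)$. The constructible topology on $\operatorname{spec}(D)$ is the coarsest topology for which all subsets that are open and compact in the Zariski topology are clopen; a subset of $\operatorname{spec}(D)$ is proconstructible if it is closed in the constructible topology. $\mathcal{B}$ carries the componentwise Boolean operations (least element $(\emptyset)_\lambda$; $Y\le Z$ iff $Y_\lambda\subseteq Z_\lambda$ for all $\lambda$); an ultrafilter in $\mathcal{B}$ is a maximal proper filter. For $a=(a_\lambda)\in R$, $S(a)=(\mathscr{V}(a_\lambda))_{\lambda\in\Lambda}\in\mathcal{B}$, and $(\mathcal{U})=\{a\in R\mid S(a)\in\mathcal{U}\}$. *)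

theory Defs
  imports "HOL-Analysis.Abstract_Topology" "HOL-Algebra.Ideal"
begin

definition product_ring :: "'i set \<Rightarrow> ('i \<Rightarrow> ('a, 'm) ring_scheme) \<Rightarrow> ('i \<Rightarrow> 'a) ring" where
  "product_ring I D =
     \<lparr>carrier = (\<Pi>\<^sub>E i\<in>I. carrier (D i)),
      monoid.mult = (\<lambda>x y. \<lambda>i\<in>I. x i \<otimes>\<^bsub>D i\<^esub> y i),
      one = (\<lambda>i\<in>I. \<one>\<^bsub>D i\<^esub>),
      zero = (\<lambda>i\<in>I. \<zero>\<^bsub>D i\<^esub>),
      add = (\<lambda>x y. \<lambda>i\<in>I. x i \<oplus>\<^bsub>D i\<^esub> y i)\<rparr>"

lemma cring_product_ring:
  assumes "\<And>i. i \<in> I \<Longrightarrow> cring (D i)"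
  shows "cring (product_ring I D)"
proof -
  have ext: "x = y" if "x \<in> (\<Pi>\<^sub>E i\<in>I. carrier (D i))" "y \<in> (\<Pi>\<^sub>E i\<in>I. carrier (D i))"
      "\<And>i. i \<in> I \<Longrightarrow> x i = y i" for x y
    using that by (rule PiE_ext)
  have closed:
    "x \<oplus>\<^bsub>product_ring I D\<^esub> y \<in> carrier (product_ring I D)"
    "x \<otimes>\<^bsub>product_ring I D\<^esub> y \<in> carrier (product_ring I D)"
    if "x \<in> carrier (product_ring I D)" "y \<in> carrier (product_ring I D)" for x y
    using that by (auto simp: product_ring_def PiE_iff cring.cring_simprules(1,5)[OF assms])
  have const:
    "\<zero>\<^bsub>product_ring I D\<^esub> \<in> carrier (product_ring I D)"
    "\<one>\<^bsub>product_ring I D\<^esub> \<in> carrier (product_ring I D)"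
    by (auto simp: product_ring_def cring.cring_simprules(2,6)[OF assms])
  have eqI: "x = y" if "x \<in> carrier (product_ring I D)" "y \<in> carrier (product_ring I D)"
      "\<And>i. i \<in> I \<Longrightarrow> x i = y i" for x y
    using that ext by (simp add: product_ring_def)
  have app: "(x \<oplus>\<^bsub>product_ring I D\<^esub> y) i = x i \<oplus>\<^bsub>D i\<^esub> y i"
    "(x \<otimes>\<^bsub>product_ring I D\<^esub> y) i = x i \<otimes>\<^bsub>D i\<^esub> y i"
    "\<zero>\<^bsub>product_ring I D\<^esub> i = \<zero>\<^bsub>D i\<^esub>" "\<one>\<^bsub>product_ring I D\<^esub> i = \<one>\<^bsub>D i\<^esub>"
    if "i \<in> I" for x y i
    using that by (simp_all add: product_ring_def)
  have mem: "x i \<in> carrier (D i)" if "x \<in> carrier (product_ring I D)" "i \<in> I" for x i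
    using that by (auto simp: product_ring_def)
  show ?thesis
  proof (rule cringI)
    show "abelian_group (product_ring I D)"
    proof (rule abelian_groupI)
      fix x assume x: "x \<in> carrier (product_ring I D)"
      define y where "y = (\<lambda>i\<in>I. \<ominus>\<^bsub>D i\<^esub> x i)"
      have y: "y \<in> carrier (product_ring I D)"
        using mem[OF x] by (auto simp: y_def product_ring_def cring.cring_simprules(3)[OF assms])
      have "y \<oplus>\<^bsub>product_ring I D\<^esub> x = \<zero>\<^bsub>product_ring I D\<^esub>"
        by (rule eqI)
          (simp_all add: closed const x y app, simp add: y_def mem[OF x] cring.cring_simprules(9)[OF assms])
      then show "\<exists>y\<in>carrier (product_ring I D). y \<oplus>\<^bsub>product_ring I D\<^esub> x = \<zero>\<^bsub>product_ring I D\<^esub>"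
        using y by blast
    qed (auto intro!: eqI simp: closed const app mem
        cring.cring_simprules(7,8)[OF assms] cring.cring_simprules(10)[OF assms])
    show "comm_monoid (product_ring I D)"
      by (rule comm_monoidI)
        (auto intro!: eqI simp: closed const app mem
          cring.cring_simprules(11,12)[OF assms] cring.cring_simprules(14)[OF assms])
  qed (auto intro!: eqI simp: closed const app mem cring.cring_simprules(13)[OF assms])
qed

definition prime_spectrum :: "('a, 'm) ring_scheme \<Rightarrow> 'a set set" where
  "prime_spectrum R = {P. primeideal P R}"

definition max_spectrum :: "('a, 'm) ring_scheme \<Rightarrow> 'a set set" where
  "max_spectrum R = {M. maximalideal M R}"

definition max_vanish :: "('a, 'm) ring_scheme \<Rightarrow> 'a \<Rightarrow> 'a set set" where
  "max_vanish R a = {M \<in> max_spectrum R. a \<in> M}"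

definition max_nonvanish :: "('a, 'm) ring_scheme \<Rightarrow> 'a \<Rightarrow> 'a set set" where
  "max_nonvanish R a = max_spectrum R - max_vanish R a"

definition zariski_topology :: "('a, 'm) ring_scheme \<Rightarrow> 'a set topology" where
  "zariski_topology R =
     topology_generated_by ((\<lambda>a. {P \<in> prime_spectrum R. a \<notin> P}) ` carrier R)"

lemma topspace_zariski_topology:
  assumes "cring R"
  shows "topspace (zariski_topology R) = prime_spectrum R"
proof -
  interpret cring R by fact
  have "\<one>\<^bsub>R\<^esub> \<notin> P" if "P \<in> prime_spectrum R" for P
  proof -
    interpret P: primeideal P R using that by (simp add: prime_spectrum_def)
    show ?thesis using P.I_notcarr P.one_imp_carrier by blast
  qed
  then show ?thesis
    by (auto simp: zariski_topology_def)
qed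

lemma closedin_zariski_topology_iff:
  assumes "cring R"
  shows "closedin (zariski_topology R) C \<longleftrightarrow>
           (\<exists>A \<subseteq> carrier R. C = {P \<in> prime_spectrum R. A \<subseteq> P})"
proof
  interpret cring R by fact
  have mult: "a \<otimes>\<^bsub>R\<^esub> b \<in> P \<longleftrightarrow> a \<in> P \<or> b \<in> P"
    if "P \<in> prime_spectrum R" "a \<in> carrier R" "b \<in> carrier R" for P a b
  proof -
    interpret P: primeideal P R using that by (simp add: prime_spectrum_def)
    show ?thesis using P.I_prime[OF that(2,3)] P.I_l_closed[OF _ that(2)] P.I_r_closed[OF _ that(3)] by blast
  qed
  have op: "\<exists>A \<subseteq> carrier R. U = {P \<in> prime_spectrum R. \<not> A \<subseteq> P}"
    if "generate_topology_on ((\<lambda>a. {P \<in> prime_spectrum R. a \<notin> P}) ` carrier R) U" for U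
    using that
  proof (induction rule: generate_topology_on.induct)
    case Empty
    then show ?case by (intro exI[of _ "{}"]) auto
  next
    case (Int U V)
    then obtain A B where AB: "A \<subseteq> carrier R" "U = {P \<in> prime_spectrum R. \<not> A \<subseteq> P}"
      "B \<subseteq> carrier R" "V = {P \<in> prime_spectrum R. \<not> B \<subseteq> P}" by blast
    have "U \<inter> V = {P \<in> prime_spectrum R. \<not> {a \<otimes>\<^bsub>R\<^esub> b | a b. a \<in> A \<and> b \<in> B} \<subseteq> P}"
      using AB mult by blast
    moreover have "{a \<otimes>\<^bsub>R\<^esub> b | a b. a \<in> A \<and> b \<in> B} \<subseteq> carrier R"
      using AB by blast
    ultimately show ?case by blast
  next
    case (UN K)
    then have "\<forall>U\<in>K. \<exists>A. A \<subseteq> carrier R \<and> U = {P \<in> prime_spectrum R. \<not> A \<subseteq> P}"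
      by blast
    from bchoice[OF this] obtain A where
      A: "\<forall>U\<in>K. A U \<subseteq> carrier R \<and> U = {P \<in> prime_spectrum R. \<not> A U \<subseteq> P}" ..
    have "P \<in> \<Union>K \<longleftrightarrow> P \<in> prime_spectrum R \<and> \<not> (\<Union>U\<in>K. A U) \<subseteq> P" for P
    proof -
      have "P \<in> U \<longleftrightarrow> P \<in> prime_spectrum R \<and> \<not> A U \<subseteq> P" if "U \<in> K" for U
        using arg_cong[where f = "\<lambda>X. P \<in> X", OF conjunct2[OF bspec[OF A that]]] by simp
      then show ?thesis
        by blast
    qed
    then have "\<Union>K = {P \<in> prime_spectrum R. \<not> (\<Union>U\<in>K. A U) \<subseteq> P}"
      by (simp add: set_eq_iff)
    moreover have "(\<Union>U\<in>K. A U) \<subseteq> carrier R"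
      using A by blast
    ultimately show ?case by blast
  next
    case (Basis U)
    then obtain a where "a \<in> carrier R" "U = {P \<in> prime_spectrum R. a \<notin> P}" by blast
    then show ?case by (intro exI[of _ "{a}"]) simp
  qed
  assume C: "closedin (zariski_topology R) C"
  then have "openin (zariski_topology R) (prime_spectrum R - C)"
    by (simp add: closedin_def topspace_zariski_topology[OF assms])
  then obtain A where A: "A \<subseteq> carrier R"
      "prime_spectrum R - C = {P \<in> prime_spectrum R. \<not> A \<subseteq> P}"
    unfolding zariski_topology_def openin_topology_generated_by_iff using op by blast
  have "C \<subseteq> prime_spectrum R"
    using closedin_subset[OF C] topspace_zariski_topology[OF assms] by simp
  with A show "\<exists>A \<subseteq> carrier R. C = {P \<in> prime_spectrum R. A \<subseteq> P}"
    by blast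
next
  assume "\<exists>A \<subseteq> carrier R. C = {P \<in> prime_spectrum R. A \<subseteq> P}"
  then obtain A where A: "A \<subseteq> carrier R" "C = {P \<in> prime_spectrum R. A \<subseteq> P}" by blast
  have "openin (zariski_topology R) (\<Union>a\<in>A. {P \<in> prime_spectrum R. a \<notin> P})"
    unfolding zariski_topology_def
    using A(1) by (intro openin_Union) (blast intro: topology_generated_by_Basis)
  moreover have "prime_spectrum R - C = (\<Union>a\<in>A. {P \<in> prime_spectrum R. a \<notin> P})"
    using A by blast
  ultimately show "closedin (zariski_topology R) C"
    using A by (auto simp: closedin_def topspace_zariski_topology[OF assms])
qed

definition constructible_topology :: "('a, 'm) ring_scheme \<Rightarrow> 'a set topology" where
  "constructible_topology R =
     (let K = {U. openin (zariski_topology R) U \<and> compactin (zariski_topology R) U}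
      in topology_generated_by (K \<union> (\<lambda>U. prime_spectrum R - U) ` K))"

lemma topspace_constructible_topology:
  assumes "cring R"
  shows "topspace (constructible_topology R) = prime_spectrum R"
proof -
  have "U \<subseteq> prime_spectrum R" if "openin (zariski_topology R) U" for U
    using openin_subset[OF that] topspace_zariski_topology[OF assms] by simp
  then show ?thesis
    by (auto simp: constructible_topology_def Let_def)
qed

lemma constructible_topology_clopen:
  assumes "cring R" "openin (zariski_topology R) U" "compactin (zariski_topology R) U"
  shows "openin (constructible_topology R) U \<and> closedin (constructible_topology R) U"
proof -
  have "U \<subseteq> prime_spectrum R"
    using openin_subset[OF assms(2)] topspace_zariski_topology[OF assms(1)] by simp
  moreover have "openin (constructible_topology R) U"
    "openin (constructible_topology R) (prime_spectrum R - U)"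
    unfolding constructible_topology_def Let_def
    by (rule topology_generated_by_Basis, use assms(2,3) in blast)+
  ultimately show ?thesis
    by (simp add: closedin_def topspace_constructible_topology[OF assms(1)])
qed

lemma constructible_topology_coarsest:
  assumes "topspace T = prime_spectrum R"
    and "\<And>U. openin (zariski_topology R) U \<Longrightarrow> compactin (zariski_topology R) U \<Longrightarrow>
           openin T U \<and> closedin T U"
    and "openin (constructible_topology R) V"
  shows "openin T V"
proof -
  have "openin T (prime_spectrum R - U)"
    if "openin (zariski_topology R) U" "compactin (zariski_topology R) U" for U
    using assms(2)[OF that] assms(1) by (simp add: closedin_def)
  then have basis: "openin T S"
    if "S \<in> {U. openin (zariski_topology R) U \<and> compactin (zariski_topology R) U} \<union>
       (\<lambda>U. prime_spectrum R - U) ` {U. openin (zariski_topology R) U \<and> compactin (zariski_topology R) U}"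
    for S
    using that assms(2) by blast
  show ?thesis
    by (rule generate_topology_on_coarsest[OF istopology_openin basis])
      (use assms(3) in \<open>simp_all add: constructible_topology_def Let_def openin_topology_generated_by_iff\<close>)
qed

definition proconstructible :: "('a, 'm) ring_scheme \<Rightarrow> 'a set set \<Rightarrow> bool" where
  "proconstructible R X \<longleftrightarrow> closedin (constructible_topology R) X"

definition Pow_product :: "'i set \<Rightarrow> ('i \<Rightarrow> 'b set) \<Rightarrow> ('i \<Rightarrow> 'b set) set" where
  "Pow_product I X = (\<Pi>\<^sub>E i\<in>I. Pow (X i))"

text \<open>Filters and ultrafilters in the Boolean algebra \<open>Pow_product I X\<close> with its componentwise
  order. These are not filters on a set, so the library type of filters does not apply.\<close>

definition Pow_product_filter :: "'i set \<Rightarrow> ('i \<Rightarrow> 'b set) \<Rightarrow> ('i \<Rightarrow> 'b set) set \<Rightarrow> bool" where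
  "Pow_product_filter I X F \<longleftrightarrow>
     F \<subseteq> Pow_product I X \<and> F \<noteq> {} \<and>
     (\<forall>Y\<in>F. \<forall>Z\<in>F. (\<lambda>i\<in>I. Y i \<inter> Z i) \<in> F) \<and>
     (\<forall>Y\<in>F. \<forall>Z\<in>Pow_product I X. (\<forall>i\<in>I. Y i \<subseteq> Z i) \<longrightarrow> Z \<in> F)"

definition Pow_product_proper_filter :: "'i set \<Rightarrow> ('i \<Rightarrow> 'b set) \<Rightarrow> ('i \<Rightarrow> 'b set) set \<Rightarrow> bool" where
  "Pow_product_proper_filter I X F \<longleftrightarrow> Pow_product_filter I X F \<and> F \<noteq> Pow_product I X"

definition Pow_product_ultrafilter :: "'i set \<Rightarrow> ('i \<Rightarrow> 'b set) \<Rightarrow> ('i \<Rightarrow> 'b set) set \<Rightarrow> bool" where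
  "Pow_product_ultrafilter I X U \<longleftrightarrow>
     Pow_product_proper_filter I X U \<and>
     (\<forall>F. Pow_product_proper_filter I X F \<and> U \<subseteq> F \<longrightarrow> F = U)"

definition vanishing_family ::
    "'i set \<Rightarrow> ('i \<Rightarrow> ('a, 'm) ring_scheme) \<Rightarrow> ('i \<Rightarrow> 'a) \<Rightarrow> 'i \<Rightarrow> 'a set set" where
  "vanishing_family I D a = (\<lambda>i\<in>I. max_vanish (D i) (a i))"

definition filter_ideal ::
    "'i set \<Rightarrow> ('i \<Rightarrow> ('a, 'm) ring_scheme) \<Rightarrow> ('i \<Rightarrow> 'a set set) set \<Rightarrow> ('i \<Rightarrow> 'a) set" where
  "filter_ideal I D U = {a \<in> carrier (product_ring I D). vanishing_family I D a \<in> U}"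

end

theory Submission
  imports Defs "HOL-Algebra.Ring_Divisibility"
begin

text \<open>
  For an ultrafilter \<open>W\<close> on a set \<open>X\<close> of prime ideals of a ring \<open>D\<close>, the elements \<open>a\<close> for which
  \<open>{P \<in> X. a \<in> P}\<close> belongs to \<open>W\<close> form a prime ideal, the limit of \<open>W\<close> in the constructible topology.
  Both (a) and (b) force all ultrafilter limits on \<open>max(D)\<close> to be maximal: under (b) because a
  closed set contains its limits, and under (a) because \<open>W\<close> pulls back to an ultrafilter \<open>U\<close> in
  the product for which \<open>(U)\<close> is the preimage of the limit under a coordinate projection.

  If all limits are maximal, let \<open>A\<close> consist of the \<open>x\<close> for which \<open>x r\<close> lies in the Jacobson radical.
  Then \<open>(r) + A = D\<close>, and writing \<open>1 = x r + d\<close> with \<open>d \<in> A\<close> yields the \<open>d\<close> of (c). Conversely, with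
  such \<open>d\<close> at hand, a non-maximal prime contained in \<open>M\<close> and omitting some \<open>r \<in> M\<close> has the
  neighbourhood of all primes omitting \<open>d r\<close>, which contains no maximal ideal; and an element \<open>a\<close>
  of the product outside \<open>(U)\<close> becomes comaximal with an element of \<open>(U)\<close>, coordinate by coordinate.
\<close>

section \<open>Ultrafilters on a set\<close>

text \<open>\<open>Diff_mem_iff\<close> encodes properness and maximality at once: of two
  complementary subsets of \<open>X\<close> exactly one is a member. Taking \<open>A = {}\<close>
  shows that an empty \<open>X\<close> carries no ultrafilter.\<close>

locale ultrafilter_on =
  fixes X :: "'b set" and W :: "'b set set"
  assumes subset_Pow: "W \<subseteq> Pow X"
    and Int_mem: "A \<in> W \<Longrightarrow> B \<in> W \<Longrightarrow> A \<inter> B \<in> W"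
    and superset_mem: "A \<in> W \<Longrightarrow> A \<subseteq> B \<Longrightarrow> B \<subseteq> X \<Longrightarrow> B \<in> W"
    and Diff_mem_iff: "A \<subseteq> X \<Longrightarrow> X - A \<in> W \<longleftrightarrow> A \<notin> W"
begin

lemma empty_notin: "{} \<notin> W"
  using Diff_mem_iff[of "{}"] superset_mem[of "{}" X] by auto

lemma carrier_mem: "X \<in> W"
  using Diff_mem_iff[of "{}"] empty_notin by simp

text \<open>If no trace \<open>X \<inter> A\<close> were a member, all their complements would be,
  and so would the intersection of these, which misses the union. Later this picks one basic open
  set out of a finite cover.\<close>

lemma finite_Union_mem:
  assumes "finite \<F>" "X \<inter> \<Union>\<F> \<in> W"
  shows "\<exists>A\<in>\<F>. X \<inter> A \<in> W"
  using assms
proof (induction rule: finite_induct)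
  case empty
  then show ?case using empty_notin by simp
next
  case (insert A \<F>)
  show ?case
  proof (rule ccontr)
    assume "\<not> ?thesis"
    then have "X - X \<inter> A \<in> W" "X - X \<inter> \<Union>\<F> \<in> W"
      using insert.IH Diff_mem_iff[of "X \<inter> A"] Diff_mem_iff[of "X \<inter> \<Union>\<F>"] by auto
    then have "(X - X \<inter> A) \<inter> (X - X \<inter> \<Union>\<F>) \<inter> (X \<inter> \<Union>(insert A \<F>)) \<in> W"
      by (intro Int_mem insert.prems)
    moreover have "(X - X \<inter> A) \<inter> (X - X \<inter> \<Union>\<F>) \<inter> (X \<inter> \<Union>(insert A \<F>)) = {}"
      by auto
    ultimately show False
      using empty_notin by simp
  qed
qed

end

text \<open>The ultrafilter lemma, by Zorn: among the families of subsets of \<open>X\<close> with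
  the finite intersection property, a maximal one is an ultrafilter.\<close>

lemma ex_ultrafilter_on:
  assumes "F \<subseteq> Pow X" and fip: "\<And>C. finite C \<Longrightarrow> C \<subseteq> F \<Longrightarrow> X \<inter> \<Inter>C \<noteq> {}"
  obtains W where "ultrafilter_on X W" "F \<subseteq> W"
proof -
  \<comment> \<open>The factor \<open>X\<close> matters for \<open>C = {}\<close>, whose
    intersection is \<open>UNIV\<close>: the property thereby includes
    \<open>X \<noteq> {}\<close>.\<close>
  define \<A> where "\<A> = {G. F \<subseteq> G \<and> G \<subseteq> Pow X \<and> (\<forall>C. finite C \<and> C \<subseteq> G \<longrightarrow> X \<inter> \<Inter>C \<noteq> {})}"
  have "\<exists>W\<in>\<A>. \<forall>G\<in>\<A>. W \<subseteq> G \<longrightarrow> G = W"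
  proof (rule subset_Zorn_nonempty)
    have "F \<in> \<A>"
      using assms by (simp add: \<A>_def)
    then show "\<A> \<noteq> {}"
      by blast
  next
    fix \<C> assume \<C>: "\<C> \<noteq> {}" "subset.chain \<A> \<C>"
    have "X \<inter> \<Inter>C \<noteq> {}" if C: "finite C" "C \<subseteq> \<Union>\<C>" for C
    proof -
      obtain G where "G \<in> \<C>" "C \<subseteq> G"
        using finite_subset_Union_chain[OF C \<C>] by blast
      then have "G \<in> \<A>"
        using \<C>(2) by (auto simp: subset_chain_def)
      then show ?thesis
        using \<open>C \<subseteq> G\<close> C(1) by (simp add: \<A>_def)
    qed
    moreover have "F \<subseteq> \<Union>\<C>" "\<Union>\<C> \<subseteq> Pow X"
      using \<C> by (auto 4 3 simp: \<A>_def subset_chain_def)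
    ultimately show "\<Union>\<C> \<in> \<A>"
      by (simp add: \<A>_def)
  qed
  then obtain W where W: "W \<in> \<A>" and max: "\<And>G. G \<in> \<A> \<Longrightarrow> W \<subseteq> G \<Longrightarrow> G = W"
    by blast
  have fipW: "X \<inter> \<Inter>C \<noteq> {}" if "finite C" "C \<subseteq> W" for C
    using W that by (simp add: \<A>_def)
  \<comment> \<open>By maximality, a set that can be adjoined without destroying the finite
    intersection property is already a member.\<close>
  have in_W: "A \<in> W" if "A \<subseteq> X" "\<And>C. finite C \<Longrightarrow> C \<subseteq> W \<Longrightarrow> X \<inter> \<Inter>C \<inter> A \<noteq> {}" for A
  proof -
    have "X \<inter> \<Inter>C \<noteq> {}" if "finite C" "C \<subseteq> insert A W" for C
      using \<open>\<And>C. finite C \<Longrightarrow> C \<subseteq> W \<Longrightarrow> X \<inter> \<Inter>C \<inter> A \<noteq> {}\<close>[of "C - {A}"] that by auto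
    moreover have "F \<subseteq> insert A W" "insert A W \<subseteq> Pow X"
      using W \<open>A \<subseteq> X\<close> by (auto simp: \<A>_def)
    ultimately have "insert A W \<in> \<A>"
      by (simp add: \<A>_def)
    then show ?thesis
      using max by blast
  qed
  \<comment> \<open>The closure properties below are instances of this: \<open>C\<close> is a pair
    for intersections, a singleton for supersets, and for complements a finite family witnessing
    that the set itself cannot be adjoined.\<close>
  have in_W': "A \<in> W" if "A \<subseteq> X" "finite C" "C \<subseteq> W" "X \<inter> \<Inter>C \<subseteq> A" for A C
  proof (rule in_W[OF \<open>A \<subseteq> X\<close>])
    fix C' assume "finite C'" "C' \<subseteq> W"
    then have "X \<inter> \<Inter>(C \<union> C') \<noteq> {}"
      using fipW[of "C \<union> C'"] that by blast
    then show "X \<inter> \<Inter>C' \<inter> A \<noteq> {}"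
      using \<open>X \<inter> \<Inter>C \<subseteq> A\<close> by blast
  qed
  have "ultrafilter_on X W"
  proof
    show "W \<subseteq> Pow X"
      using W by (simp add: \<A>_def)
    fix A B
    show "A \<inter> B \<in> W" if "A \<in> W" "B \<in> W"
      using that \<open>W \<subseteq> Pow X\<close> by (intro in_W'[of _ "{A, B}"]) auto
    show "B \<in> W" if "A \<in> W" "A \<subseteq> B" "B \<subseteq> X"
      using that by (intro in_W'[of _ "{A}"]) auto
    show "X - A \<in> W \<longleftrightarrow> A \<notin> W" if "A \<subseteq> X"
    proof
      show "A \<notin> W" if "X - A \<in> W"
        using fipW[of "{A, X - A}"] that by auto
      assume "A \<notin> W"
      then obtain C where "finite C" "C \<subseteq> W" "X \<inter> \<Inter>C \<inter> A = {}"
        using in_W[OF \<open>A \<subseteq> X\<close>] by blast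
      then show "X - A \<in> W"
        by (intro in_W'[of _ C]) auto
    qed
  qed
  then show ?thesis
    using that W by (simp add: \<A>_def)
qed

section \<open>Ideals and prime ideals\<close>

lemma (in cring) idealI':
  assumes "J \<subseteq> carrier R" "\<zero> \<in> J"
    and add: "\<And>x y. x \<in> J \<Longrightarrow> y \<in> J \<Longrightarrow> x \<oplus> y \<in> J"
    and mult: "\<And>x r. x \<in> J \<Longrightarrow> r \<in> carrier R \<Longrightarrow> r \<otimes> x \<in> J"
  shows "ideal J R"
proof (rule idealI[OF ring_axioms])
  show "subgroup J (add_monoid R)"
  proof (rule add.subgroupI)
    fix x assume "x \<in> J"
    then have "\<ominus> x = (\<ominus> \<one>) \<otimes> x"
      using assms(1) by (auto simp: l_minus)
    then show "\<ominus> x \<in> J"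
      using mult[OF \<open>x \<in> J\<close>] by simp
  qed (use assms in auto)
  fix x r assume "x \<in> J" "r \<in> carrier R"
  then show "r \<otimes> x \<in> J" "x \<otimes> r \<in> J"
    using mult[of x r] assms(1) m_comm[of x r] by auto
qed

text \<open>Krull's theorem. In the Zorn argument properness is expressed by
  \<open>\<one> \<notin> K\<close>, a form that passes to unions of chains.\<close>

lemma (in ring) ex_maximalideal:
  assumes "ideal J R" "J \<noteq> carrier R"
  obtains M where "maximalideal M R" "J \<subseteq> M"
proof -
  define \<A> where "\<A> = {K. ideal K R \<and> J \<subseteq> K \<and> \<one> \<notin> K}"
  have "\<exists>M\<in>\<A>. \<forall>K\<in>\<A>. M \<subseteq> K \<longrightarrow> K = M"
  proof (rule subset_Zorn_nonempty)
    show "\<A> \<noteq> {}"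
      using assms ideal.one_imp_carrier by (auto simp: \<A>_def)
  next
    fix \<C> assume \<C>: "\<C> \<noteq> {}" "subset.chain \<A> \<C>"
    then have "subset.chain {I. ideal I R} \<C>"
      by (auto simp: subset_chain_def \<A>_def)
    from chain_Union_is_ideal[OF this] show "\<Union>\<C> \<in> \<A>"
      using \<C> by (auto simp: subset_chain_def \<A>_def)
  qed
  then obtain M where M: "M \<in> \<A>" "\<And>K. K \<in> \<A> \<Longrightarrow> M \<subseteq> K \<Longrightarrow> K = M"
    by blast
  have "maximalideal M R"
  proof (rule maximalidealI)
    show "ideal M R" "carrier R \<noteq> M"
      using M by (auto simp: \<A>_def)
    fix K assume "ideal K R" "M \<subseteq> K"
    then show "K = M \<or> K = carrier R"
      using M ideal.one_imp_carrier[of K R] by (auto simp: \<A>_def)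
  qed
  then show ?thesis
    using that M by (simp add: \<A>_def)
qed

lemma (in cring) max_spectrum_subset_prime_spectrum: "max_spectrum R \<subseteq> prime_spectrum R"
  using maximalideal_prime by (auto simp: max_spectrum_def prime_spectrum_def)

lemma (in cring) prime_spectrumD:
  assumes "P \<in> prime_spectrum R"
  shows "\<zero> \<in> P" "\<one> \<notin> P"
    and "a \<in> P \<Longrightarrow> b \<in> P \<Longrightarrow> a \<oplus> b \<in> P"
    and "a \<in> carrier R \<Longrightarrow> b \<in> carrier R \<Longrightarrow> a \<otimes> b \<in> P \<longleftrightarrow> a \<in> P \<or> b \<in> P"
proof -
  interpret P: primeideal P R
    using assms by (simp add: prime_spectrum_def)
  show "\<zero> \<in> P" "a \<in> P \<Longrightarrow> b \<in> P \<Longrightarrow> a \<oplus> b \<in> P"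
    by auto
  show "\<one> \<notin> P"
    using P.I_notcarr P.one_imp_carrier by blast
  show "a \<otimes> b \<in> P \<longleftrightarrow> a \<in> P \<or> b \<in> P" if "a \<in> carrier R" "b \<in> carrier R"
    using P.I_prime[OF that] P.I_l_closed[OF _ that(1)] P.I_r_closed[OF _ that(2)] by blast
qed

lemma (in cring) max_spectrumD:
  assumes "M \<in> max_spectrum R"
  shows "\<zero> \<in> M" "\<one> \<notin> M"
    and "a \<in> M \<Longrightarrow> b \<in> M \<Longrightarrow> a \<oplus> b \<in> M"
    and "a \<in> carrier R \<Longrightarrow> b \<in> carrier R \<Longrightarrow> a \<otimes> b \<in> M \<longleftrightarrow> a \<in> M \<or> b \<in> M"
  using prime_spectrumD[OF subsetD[OF max_spectrum_subset_prime_spectrum assms]] by simp_all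

text \<open>The sum of \<open>PIdl r\<close> and \<open>J\<close> lies in no maximal ideal, so by
  Krull it is the whole ring and \<open>\<one>\<close> splits accordingly.\<close>

lemma (in cring) comaximal:
  assumes "ideal J R" "r \<in> carrier R" "\<And>M. M \<in> max_spectrum R \<Longrightarrow> r \<in> M \<Longrightarrow> \<not> J \<subseteq> M"
  obtains x y where "x \<in> carrier R" "y \<in> J" "\<one> = x \<otimes> r \<oplus> y"
proof -
  have ideal: "ideal (PIdl r <+>\<^bsub>R\<^esub> J) R"
    by (intro add_ideals cgenideal_ideal assms)
  have sub: "PIdl r \<subseteq> PIdl r <+>\<^bsub>R\<^esub> J" "J \<subseteq> PIdl r <+>\<^bsub>R\<^esub> J"
  proof -
    have "x \<oplus> \<zero> \<in> PIdl r <+>\<^bsub>R\<^esub> J" if "x \<in> PIdl r" for x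
      using that additive_subgroup.zero_closed[OF ideal.axioms(1)[OF assms(1)]]
      unfolding set_add_def' by blast
    then show "PIdl r \<subseteq> PIdl r <+>\<^bsub>R\<^esub> J"
      using ideal.Icarr[OF cgenideal_ideal[OF assms(2)]] by fastforce
    have "\<zero> \<oplus> x \<in> PIdl r <+>\<^bsub>R\<^esub> J" if "x \<in> J" for x
      using that additive_subgroup.zero_closed[OF ideal.axioms(1)[OF cgenideal_ideal[OF assms(2)]]]
      unfolding set_add_def' by blast
    then show "J \<subseteq> PIdl r <+>\<^bsub>R\<^esub> J"
      using ideal.Icarr[OF assms(1)] by fastforce
  qed
  have "PIdl r <+>\<^bsub>R\<^esub> J = carrier R"
  proof (rule ccontr)
    assume "PIdl r <+>\<^bsub>R\<^esub> J \<noteq> carrier R"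
    then obtain M where "maximalideal M R" "PIdl r <+>\<^bsub>R\<^esub> J \<subseteq> M"
      using ex_maximalideal[OF ideal] by blast
    then show False
      using assms(3)[of M] sub cgenideal_self[OF assms(2)] by (auto simp: max_spectrum_def)
  qed
  then have "\<one> \<in> PIdl r <+>\<^bsub>R\<^esub> J"
    by simp
  then show ?thesis
    using that unfolding set_add_def' cgenideal_def by blast
qed

section \<open>Limits of ultrafilters of prime ideals\<close>

definition ultrafilter_limit :: "('a, 'm) ring_scheme \<Rightarrow> 'a set set \<Rightarrow> 'a set set set \<Rightarrow> 'a set" where
  "ultrafilter_limit R X W = {a \<in> carrier R. {P \<in> X. a \<in> P} \<in> W}"

lemma ultrafilter_limit_notin_iff:
  assumes "ultrafilter_on X W" "a \<in> carrier R"
  shows "a \<notin> ultrafilter_limit R X W \<longleftrightarrow> {P \<in> X. a \<notin> P} \<in> W"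
proof -
  have "X - {P \<in> X. a \<in> P} = {P \<in> X. a \<notin> P}"
    by auto
  then show ?thesis
    using ultrafilter_on.Diff_mem_iff[OF assms(1), of "{P \<in> X. a \<in> P}"] assms(2)
    by (auto simp: ultrafilter_limit_def)
qed

text \<open>Each condition on a prime ideal concerns finitely many elements and holds throughout
  \<open>X\<close>, so it passes to the limit. Primality rests on \<open>W\<close> deciding every
  subset of \<open>X\<close>: what the limit omits is omitted on a member of
  \<open>W\<close>.\<close>

lemma (in cring) ultrafilter_limit_mem_prime_spectrum:
  assumes X: "X \<subseteq> prime_spectrum R" and W: "ultrafilter_on X W"
  shows "ultrafilter_limit R X W \<in> prime_spectrum R"
proof -
  interpret W: ultrafilter_on X W by fact
  let ?L = "ultrafilter_limit R X W"
  have notin: "a \<notin> ?L \<longleftrightarrow> {P \<in> X. a \<notin> P} \<in> W" if "a \<in> carrier R" for a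
    using ultrafilter_limit_notin_iff[OF W that] .
  have one: "\<one> \<notin> ?L"
  proof -
    have "{P \<in> X. \<one> \<notin> P} = X"
      using X prime_spectrumD(2) by auto
    then show ?thesis
      using notin W.carrier_mem by simp
  qed
  have "primeideal ?L R"
  proof (rule primeidealI)
    show "ideal ?L R"
    proof (rule idealI')
      show "?L \<subseteq> carrier R"
        by (auto simp: ultrafilter_limit_def)
      have "{P \<in> X. \<zero> \<in> P} = X"
        using X prime_spectrumD(1) by auto
      then show "\<zero> \<in> ?L"
        using W.carrier_mem by (simp add: ultrafilter_limit_def)
    next
      fix x y assume xy: "x \<in> ?L" "y \<in> ?L"
      then have "{P \<in> X. x \<in> P} \<inter> {P \<in> X. y \<in> P} \<in> W"
        by (intro W.Int_mem) (auto simp: ultrafilter_limit_def)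
      moreover have "{P \<in> X. x \<in> P} \<inter> {P \<in> X. y \<in> P} \<subseteq> {P \<in> X. x \<oplus> y \<in> P}"
        using X prime_spectrumD(3) by auto
      ultimately have "{P \<in> X. x \<oplus> y \<in> P} \<in> W"
        by (rule W.superset_mem) auto
      then show "x \<oplus> y \<in> ?L"
        using xy by (simp add: ultrafilter_limit_def)
    next
      fix x r assume xr: "x \<in> ?L" "r \<in> carrier R"
      then have "{P \<in> X. x \<in> P} \<in> W" "x \<in> carrier R"
        by (auto simp: ultrafilter_limit_def)
      then have "{P \<in> X. r \<otimes> x \<in> P} \<in> W"
        using X xr(2) prime_spectrumD(4)[of _ r x] by (auto intro: W.superset_mem)
      then show "r \<otimes> x \<in> ?L"
        using xr \<open>x \<in> carrier R\<close> by (simp add: ultrafilter_limit_def)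
    qed
    show "carrier R \<noteq> ?L"
      using one by auto
    fix a b assume ab: "a \<in> carrier R" "b \<in> carrier R" "a \<otimes> b \<in> ?L"
    show "a \<in> ?L \<or> b \<in> ?L"
    proof (rule ccontr)
      assume "\<not> ?thesis"
      then have "{P \<in> X. a \<notin> P} \<inter> {P \<in> X. b \<notin> P} \<in> W"
        using notin ab by (intro W.Int_mem) auto
      moreover have "{P \<in> X. a \<notin> P} \<inter> {P \<in> X. b \<notin> P} = {P \<in> X. a \<otimes> b \<notin> P}"
        using X ab prime_spectrumD(4)[of _ a b] by auto
      ultimately show False
        using notin[of "a \<otimes> b"] ab by simp
    qed
  qed (rule cring_axioms)
  then show ?thesis
    by (simp add: prime_spectrum_def)
qed

lemma openin_zariski_topology_basic:
  assumes "a \<in> carrier R"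
  shows "openin (zariski_topology R) {P \<in> prime_spectrum R. a \<notin> P}"
  unfolding zariski_topology_def using assms by (blast intro: topology_generated_by_Basis)

text \<open>The generating sets form a base: a closed set consists of the primes containing some
  \<open>A\<close>, and a single \<open>b \<in> A\<close> outside \<open>P\<close> already separates
  \<open>P\<close> from it.\<close>

lemma (in cring) openin_zariski_topology_basicD:
  assumes "openin (zariski_topology R) U" "P \<in> U"
  obtains b where "b \<in> carrier R" "b \<notin> P" "{Q \<in> prime_spectrum R. b \<notin> Q} \<subseteq> U"
proof -
  have "closedin (zariski_topology R) (prime_spectrum R - U)"
    using assms(1) topspace_zariski_topology[OF cring_axioms] by (metis openin_closedin_eq)
  then obtain A where A: "A \<subseteq> carrier R" "prime_spectrum R - U = {Q \<in> prime_spectrum R. A \<subseteq> Q}"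
    by (auto simp: closedin_zariski_topology_iff[OF cring_axioms])
  have "P \<in> prime_spectrum R"
    using openin_subset[OF assms(1)] assms(2) topspace_zariski_topology[OF cring_axioms] by auto
  then obtain b where "b \<in> A" "b \<notin> P"
    using A(2) assms(2) by blast
  then show ?thesis
    using A that[of b] by blast
qed

text \<open>Without a finite subcover, the complements of the covering sets lie in one ultrafilter.
  Its limit is a prime omitting \<open>a\<close>, hence belongs to some \<open>U\<close> of the
  cover. A basic neighbourhood of the limit inside \<open>U\<close> then has its trace in the
  ultrafilter, although it is disjoint from the member \<open>?X - U\<close>.\<close>

lemma (in cring) compactin_zariski_topology_basic:
  assumes a: "a \<in> carrier R"
  shows "compactin (zariski_topology R) {P \<in> prime_spectrum R. a \<notin> P}" (is "compactin _ ?X")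
  unfolding compactin_def
proof (intro conjI allI impI)
  show "?X \<subseteq> topspace (zariski_topology R)"
    by (auto simp: topspace_zariski_topology[OF cring_axioms])
  fix \<U> assume \<U>: "(\<forall>U\<in>\<U>. openin (zariski_topology R) U) \<and> ?X \<subseteq> \<Union>\<U>"
  show "\<exists>\<F>. finite \<F> \<and> \<F> \<subseteq> \<U> \<and> ?X \<subseteq> \<Union>\<F>"
  proof (rule ccontr)
    assume neg: "\<not> ?thesis"
    have fip: "?X \<inter> \<Inter>C \<noteq> {}" if C: "finite C" "C \<subseteq> (\<lambda>U. ?X - U) ` \<U>" for C
    proof -
      obtain \<F> where "finite \<F>" "\<F> \<subseteq> \<U>" "C = (\<lambda>U. ?X - U) ` \<F>"
        using finite_subset_image[OF C] by blast
      moreover from this have "\<not> ?X \<subseteq> \<Union>\<F>"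
        using neg by blast
      ultimately show ?thesis
        by blast
    qed
    obtain W where W: "ultrafilter_on ?X W" "(\<lambda>U. ?X - U) ` \<U> \<subseteq> W"
      by (rule ex_ultrafilter_on[OF _ fip]) auto
    interpret W: ultrafilter_on ?X W by fact
    let ?L = "ultrafilter_limit R ?X W"
    have "?L \<in> prime_spectrum R"
      by (rule ultrafilter_limit_mem_prime_spectrum[OF _ W(1)]) auto
    moreover have "a \<notin> ?L"
    proof -
      have "{P \<in> ?X. a \<notin> P} = ?X"
        by auto
      then show ?thesis
        using ultrafilter_limit_notin_iff[OF W(1) a] W.carrier_mem by simp
    qed
    ultimately obtain U where U: "U \<in> \<U>" "?L \<in> U" "openin (zariski_topology R) U"
      using \<U> by blast
    obtain b where b: "b \<in> carrier R" "b \<notin> ?L" "{Q \<in> prime_spectrum R. b \<notin> Q} \<subseteq> U"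
      using openin_zariski_topology_basicD[OF U(3,2)] by blast
    then have "{P \<in> ?X. b \<notin> P} \<inter> (?X - U) \<in> W"
      using ultrafilter_limit_notin_iff[OF W(1) b(1)] W(2) U(1) by (intro W.Int_mem) auto
    moreover have "{P \<in> ?X. b \<notin> P} \<inter> (?X - U) = {}"
      using b(3) by auto
    ultimately show False
      using W.empty_notin by simp
  qed
qed

text \<open>This is convergence of \<open>W\<close> to its limit in the constructible topology; it
  is checked on the generators and carried through finite intersections and unions.\<close>

lemma (in cring) ultrafilter_limit_openin_constructible:
  assumes X: "X \<subseteq> prime_spectrum R" and W: "ultrafilter_on X W"
    and V: "openin (constructible_topology R) V" and mem: "ultrafilter_limit R X W \<in> V"
  shows "X \<inter> V \<in> W"
proof -
  interpret W: ultrafilter_on X W by fact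
  let ?L = "ultrafilter_limit R X W"
  define K where "K = {U. openin (zariski_topology R) U \<and> compactin (zariski_topology R) U}"
  have L: "?L \<in> prime_spectrum R"
    using ultrafilter_limit_mem_prime_spectrum[OF X W] .
  \<comment> \<open>The converse direction, which rests on compactness of \<open>U\<close>, is what
    handles the generators \<open>prime_spectrum R - U\<close>.\<close>
  have K: "?L \<in> U \<longleftrightarrow> X \<inter> U \<in> W" if "U \<in> K" for U
  proof -
    have U: "openin (zariski_topology R) U" "compactin (zariski_topology R) U"
      using that by (simp_all add: K_def)
    show ?thesis
    proof
      assume "?L \<in> U"
      then obtain b where b: "b \<in> carrier R" "b \<notin> ?L" "{Q \<in> prime_spectrum R. b \<notin> Q} \<subseteq> U"
        using openin_zariski_topology_basicD[OF U(1)] by blast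
      then have "{P \<in> X. b \<notin> P} \<in> W"
        using ultrafilter_limit_notin_iff[OF W b(1)] by simp
      then show "X \<inter> U \<in> W"
        by (rule W.superset_mem) (use b X in auto)
    next
      assume *: "X \<inter> U \<in> W"
      \<comment> \<open>Compactness leaves finitely many basic sets covering \<open>U\<close>. The
        trace of one of them is then in \<open>W\<close>, and that basic set contains the
        limit.\<close>
      define \<U> where "\<U> = {{Q \<in> prime_spectrum R. b \<notin> Q} | b.
        b \<in> carrier R \<and> {Q \<in> prime_spectrum R. b \<notin> Q} \<subseteq> U}"
      have "\<exists>\<F>. finite \<F> \<and> \<F> \<subseteq> \<U> \<and> U \<subseteq> \<Union>\<F>"
      proof (rule compactinD)
        show "compactin (zariski_topology R) U"
          by (rule U)
        show "openin (zariski_topology R) S" if "S \<in> \<U>" for S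
          using that openin_zariski_topology_basic by (auto simp: \<U>_def)
        show "U \<subseteq> \<Union>\<U>"
        proof
          fix P assume "P \<in> U"
          moreover from this obtain b where "b \<in> carrier R" "b \<notin> P" "{Q \<in> prime_spectrum R. b \<notin> Q} \<subseteq> U"
            using openin_zariski_topology_basicD[OF U(1)] by blast
          moreover have "P \<in> prime_spectrum R"
            using \<open>P \<in> U\<close> openin_subset[OF U(1)] topspace_zariski_topology[OF cring_axioms] by auto
          ultimately show "P \<in> \<Union>\<U>"
            unfolding \<U>_def by blast
        qed
      qed
      then obtain \<F> where \<F>: "finite \<F>" "\<F> \<subseteq> \<U>" "U \<subseteq> \<Union>\<F>"
        by blast
      have "X \<inter> \<Union>\<F> \<in> W"
        by (rule W.superset_mem[OF *]) (use \<F> in auto)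
      from W.finite_Union_mem[OF \<F>(1) this] obtain A where "A \<in> \<F>" "X \<inter> A \<in> W"
        by blast
      then obtain b where b: "b \<in> carrier R" "{Q \<in> prime_spectrum R. b \<notin> Q} \<subseteq> U"
        "X \<inter> {Q \<in> prime_spectrum R. b \<notin> Q} \<in> W"
        using \<F>(2) unfolding \<U>_def by blast
      have "X \<inter> {Q \<in> prime_spectrum R. b \<notin> Q} = {P \<in> X. b \<notin> P}"
        using X by auto
      then show "?L \<in> U"
        using ultrafilter_limit_notin_iff[OF W b(1)] b L by auto
    qed
  qed
  have "generate_topology_on (K \<union> (\<lambda>U. prime_spectrum R - U) ` K) V"
    using V by (simp add: constructible_topology_def Let_def K_def openin_topology_generated_by_iff)
  then show ?thesis
    using mem
  proof (induction rule: generate_topology_on.induct)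
    case (Int U V)
    then show ?case
      using W.Int_mem[of "X \<inter> U" "X \<inter> V"] by (simp add: Int_ac)
  next
    case (UN \<K>)
    then obtain U where U: "U \<in> \<K>" "X \<inter> U \<in> W"
      by blast
    then show ?case
      by (intro W.superset_mem[OF U(2)]) auto
  next
    case (Basis S)
    then consider "S \<in> K" | U where "U \<in> K" "S = prime_spectrum R - U"
      by blast
    then show ?case
    proof cases
      case 1
      then show ?thesis using K Basis by blast
    next
      case 2
      have "X \<inter> S = X - X \<inter> U"
        using 2 X by auto
      then show ?thesis
        using K[OF 2(1)] W.Diff_mem_iff[of "X \<inter> U"] Basis 2 by auto
    qed
  qed auto
qed

text \<open>Otherwise the complement of \<open>X\<close> would be an open neighbourhood of the
  limit, and its empty trace on \<open>X\<close> would belong to \<open>W\<close>.\<close>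

lemma (in cring) ultrafilter_limit_mem_proconstructible:
  assumes "proconstructible R X" "ultrafilter_on X W"
  shows "ultrafilter_limit R X W \<in> X"
proof (rule ccontr)
  assume notin: "ultrafilter_limit R X W \<notin> X"
  have closed: "closedin (constructible_topology R) X"
    using assms(1) by (simp add: proconstructible_def)
  then have X: "X \<subseteq> prime_spectrum R"
    using closedin_subset topspace_constructible_topology[OF cring_axioms] by metis
  have "openin (constructible_topology R) (prime_spectrum R - X)"
    using closed by (simp add: closedin_def topspace_constructible_topology[OF cring_axioms])
  then have "X \<inter> (prime_spectrum R - X) \<in> W"
    using ultrafilter_limit_openin_constructible[OF X assms(2)] notin
      ultrafilter_limit_mem_prime_spectrum[OF X assms(2)] by blast
  moreover have "X \<inter> (prime_spectrum R - X) = {}"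
    by auto
  ultimately show False
    using ultrafilter_on.empty_notin[OF assms(2)] by simp
qed

section \<open>Complements of vanishing sets in the maximal spectrum\<close>

text \<open>Phrased through limits alone, so that (a) and (b) both reach (c) by it. The ideal
  \<open>A\<close> of the proof is the colon ideal of the Jacobson radical by
  \<open>r\<close>.\<close>

lemma (in cring) max_nonvanish_eq_max_vanish_if_ultrafilter_limits_maximal:
  assumes limits: "\<And>W. ultrafilter_on (max_spectrum R) W \<Longrightarrow>
      maximalideal (ultrafilter_limit R (max_spectrum R) W) R"
    and r: "r \<in> carrier R"
  obtains d where "d \<in> carrier R" "max_nonvanish R r = max_vanish R d"
proof -
  let ?X = "max_spectrum R"
  define A where "A = {x \<in> carrier R. \<forall>M\<in>?X. x \<otimes> r \<in> M}"
  have A: "ideal A R"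
  proof (rule idealI')
    show "x \<oplus> y \<in> A" if "x \<in> A" "y \<in> A" for x y
      using that r max_spectrumD(3) by (simp add: A_def l_distr)
    show "s \<otimes> x \<in> A" if "x \<in> A" "s \<in> carrier R" for x s
      using that r max_spectrumD(4)[of _ s "x \<otimes> r"] by (simp add: A_def m_assoc)
  qed (use r in \<open>auto simp: A_def max_spectrumD(1)\<close>)
  \<comment> \<open>If \<open>(r) + A \<subseteq> M\<close>, the sets \<open>E s\<close> below with \<open>s \<notin> M\<close> have the finite intersection property, and the
    limit of an ultrafilter containing them would be strictly contained in \<open>M\<close>, as it omits \<open>r\<close>.\<close>
  have "\<not> A \<subseteq> M" if M: "M \<in> ?X" "r \<in> M" for M
  proof
    assume "A \<subseteq> M"
    interpret M: maximalideal M R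
      using M by (simp add: max_spectrum_def)
    define E where "E s = {N \<in> ?X. s \<notin> N \<and> r \<notin> N}" for s
    have E: "E (s \<otimes> t) = E s \<inter> E t" if "s \<in> carrier R" "t \<in> carrier R" for s t
      using that by (auto simp: E_def max_spectrumD)
    \<comment> \<open>Products of elements outside the prime ideal \<open>M\<close> stay outside
      \<open>M\<close>, so finite intersections of sets \<open>E s\<close> contain such a set
      again.\<close>
    have fip: "\<exists>s\<in>carrier R - M. E s \<subseteq> \<Inter>C" if "finite C" "C \<subseteq> E ` (carrier R - M)" for C
      using that
    proof (induction rule: finite_induct)
      case empty
      then show ?case
        using max_spectrumD(2)[OF M(1)] by auto
    next
      case (insert B C)
      then obtain s t where "s \<in> carrier R - M" "t \<in> carrier R - M" "E s \<subseteq> \<Inter>C" "B = E t"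
        by auto
      then show ?case
        using E[of s t] max_spectrumD(4)[OF M(1), of s t] by (intro bexI[of _ "s \<otimes> t"]) auto
    qed
    \<comment> \<open>If \<open>E s\<close> were empty, every maximal ideal would contain
      \<open>s\<close> or \<open>r\<close>, hence \<open>s \<otimes> r\<close>, which puts
      \<open>s\<close> into \<open>A \<subseteq> M\<close>.\<close>
    have nonempty: "E s \<noteq> {}" if "s \<in> carrier R - M" for s
      using that \<open>A \<subseteq> M\<close> r by (auto simp: A_def E_def max_spectrumD)
    have E_subset: "E s \<subseteq> ?X" for s
      by (auto simp: E_def)
    have fipE: "?X \<inter> \<Inter>C \<noteq> {}" if C: "finite C" "C \<subseteq> E ` (carrier R - M)" for C
    proof -
      obtain s where s: "s \<in> carrier R - M" "E s \<subseteq> \<Inter>C"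
        using fip[OF C] by blast
      show ?thesis
        using nonempty[OF s(1)] s(2) E_subset[of s] by blast
    qed
    have "E ` (carrier R - M) \<subseteq> Pow ?X"
      using E_subset by blast
    from ex_ultrafilter_on[OF this fipE]
    obtain W where W: "ultrafilter_on ?X W" "E ` (carrier R - M) \<subseteq> W"
      by blast
    interpret W: ultrafilter_on ?X W by fact
    have E_mem: "E s \<in> W" if "s \<in> carrier R - M" for s
      using W(2) that by blast
    let ?L = "ultrafilter_limit R ?X W"
    interpret L: maximalideal ?L R
      using limits[OF W(1)] .
    have notin: "b \<notin> ?L" if "b \<in> carrier R - M" for b
    proof -
      have "{P \<in> ?X. b \<notin> P} \<in> W"
        by (rule W.superset_mem[OF E_mem[OF that]]) (auto simp: E_def)
      then show ?thesis
        using ultrafilter_limit_notin_iff[OF W(1)] that by auto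
    qed
    then have "?L \<subseteq> M"
      using L.Icarr by blast
    \<comment> \<open>\<open>?L\<close> is maximal and \<open>M\<close> is proper, so the inclusion
      is an equality. It fails at \<open>r\<close>, which \<open>M\<close> contains and which every
      ideal in \<open>E \<one>\<close>, and therefore the limit, omits.\<close>
    then have "M = ?L"
      using L.I_maximal[OF M.is_ideal] M.I_notcarr M.Icarr by blast
    moreover have "r \<notin> ?L"
    proof -
      have "{P \<in> ?X. r \<notin> P} \<in> W"
        by (rule W.superset_mem[OF E_mem[of \<one>]])
          (use max_spectrumD(2)[OF M(1)] in \<open>auto simp: E_def\<close>)
      then show ?thesis
        using ultrafilter_limit_notin_iff[OF W(1) r] by simp
    qed
    ultimately show False
      using M(2) by simp
  qed
  then obtain x d where xd: "x \<in> carrier R" "d \<in> A" "\<one> = x \<otimes> r \<oplus> d"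
    using comaximal[OF A r] by blast
  \<comment> \<open>Membership of \<open>d\<close> in \<open>A\<close> forces every maximal ideal to
    contain \<open>d\<close> or \<open>r\<close>; the equation for \<open>\<one>\<close> excludes
    both at once.\<close>
  have "r \<in> M \<longleftrightarrow> d \<notin> M" if M: "M \<in> ?X" for M
  proof -
    have "d \<otimes> r \<in> M" "d \<in> carrier R"
      using xd(2) M by (auto simp: A_def)
    moreover have "\<not> (r \<in> M \<and> d \<in> M)"
      using max_spectrumD(3)[OF M, of "x \<otimes> r" d] max_spectrumD(4)[OF M xd(1) r] max_spectrumD(2)[OF M]
        xd(3) by auto
    ultimately show ?thesis
      using max_spectrumD(4)[OF M _ r] by blast
  qed
  then have "max_nonvanish R r = max_vanish R d"
    by (auto simp: max_nonvanish_def max_vanish_def)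
  moreover have "d \<in> carrier R"
    using xd(2) by (simp add: A_def)
  ultimately show ?thesis
    by (rule that[rotated])
qed

lemma (in cring) proconstructible_max_spectrum:
  assumes compl: "\<And>r. r \<in> carrier R \<Longrightarrow> \<exists>d\<in>carrier R. max_nonvanish R r = max_vanish R d"
  shows "proconstructible R (max_spectrum R)"
proof -
  have "\<exists>V. openin (constructible_topology R) V \<and> P \<in> V \<and> V \<subseteq> prime_spectrum R - max_spectrum R"
    if P: "P \<in> prime_spectrum R - max_spectrum R" for P
  proof -
    interpret P: primeideal P R
      using P by (simp add: prime_spectrum_def)
    obtain M where M: "maximalideal M R" "P \<subseteq> M"
      using ex_maximalideal[OF P.is_ideal] P.I_notcarr by metis
    have "P \<noteq> M"
      using P M(1) by (auto simp: max_spectrum_def)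
    then obtain r where r: "r \<in> M" "r \<notin> P"
      using M(2) by blast
    have M': "M \<in> max_spectrum R" and rc: "r \<in> carrier R"
      using M r ideal.Icarr[OF maximalideal.axioms(1)] by (auto simp: max_spectrum_def)
    obtain d where d: "d \<in> carrier R" "max_nonvanish R r = max_vanish R d"
      using compl[OF rc] by blast
    then have *: "r \<in> N \<longleftrightarrow> d \<notin> N" if "N \<in> max_spectrum R" for N
      using that by (auto simp: max_nonvanish_def max_vanish_def)
    \<comment> \<open>This set is Zariski open and compact. It contains \<open>P\<close>, since
      \<open>r \<notin> P\<close> and \<open>d\<close> is not even in \<open>M\<close>. It misses
      every maximal ideal, since each contains \<open>d\<close> or \<open>r\<close>.\<close>
    let ?V = "{Q \<in> prime_spectrum R. d \<otimes> r \<notin> Q}"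
    have "openin (constructible_topology R) ?V"
      using d(1) rc
      by (intro conjunct1[OF constructible_topology_clopen[OF cring_axioms]]
          openin_zariski_topology_basic compactin_zariski_topology_basic m_closed)
    moreover have "P \<in> ?V"
      using P *[OF M'] r M(2) d(1) rc prime_spectrumD(4)[of P d r] by auto
    moreover have "?V \<subseteq> prime_spectrum R - max_spectrum R"
      using * max_spectrumD(4)[OF _ d(1) rc] by auto
    ultimately show ?thesis
      by blast
  qed
  then have "openin (constructible_topology R) (prime_spectrum R - max_spectrum R)"
    by (subst openin_subopen) blast
  then show ?thesis
    using max_spectrum_subset_prime_spectrum
    by (simp add: proconstructible_def closedin_def topspace_constructible_topology[OF cring_axioms])
qed

section \<open>Ultrafilters in products of power sets\<close>

lemma Pow_product_iff:
  "Y \<in> Pow_product I X \<longleftrightarrow> Y \<in> extensional I \<and> (\<forall>i\<in>I. Y i \<subseteq> X i)"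
  by (auto simp: Pow_product_def PiE_iff)

text \<open>The pullback of \<open>W\<close> along evaluation at \<open>j\<close>, a surjective
  Boolean homomorphism onto \<open>Pow (X j)\<close>.\<close>

lemma Pow_product_ultrafilter_pullback:
  assumes "j \<in> I" "ultrafilter_on (X j) W"
  shows "Pow_product_ultrafilter I X {Y \<in> Pow_product I X. Y j \<in> W}" (is "Pow_product_ultrafilter I X ?U")
proof -
  interpret W: ultrafilter_on "X j" W by fact
  \<comment> \<open>These are the least members of \<open>?U\<close> with component \<open>A\<close>
    at \<open>j\<close>.\<close>
  have in_U: "(\<lambda>i\<in>I. if i = j then A else {}) \<in> ?U" if "A \<in> W" for A
  proof -
    have "A \<subseteq> X j"
      using that W.subset_Pow by blast
    then show ?thesis
      using that \<open>j \<in> I\<close> by (simp add: Pow_product_iff)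
  qed
  have "Pow_product_filter I X ?U"
    unfolding Pow_product_filter_def
  proof (intro conjI ballI impI)
    show "?U \<subseteq> Pow_product I X" "?U \<noteq> {}"
      using in_U[OF W.carrier_mem] by blast+
    fix Y Z assume Y: "Y \<in> ?U"
    show "(\<lambda>i\<in>I. Y i \<inter> Z i) \<in> ?U" if "Z \<in> ?U"
      using Y that \<open>j \<in> I\<close> W.Int_mem by (auto simp: Pow_product_iff)
    show "Z \<in> ?U" if "Z \<in> Pow_product I X" "\<forall>i\<in>I. Y i \<subseteq> Z i"
      using Y that \<open>j \<in> I\<close> W.superset_mem[of "Y j" "Z j"] by (simp add: Pow_product_iff)
  qed
  moreover have "(\<lambda>i\<in>I. {}) \<in> Pow_product I X - ?U"
    using \<open>j \<in> I\<close> W.empty_notin by (auto simp: Pow_product_iff)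
  ultimately have "Pow_product_proper_filter I X ?U"
    unfolding Pow_product_proper_filter_def by blast
  moreover have "F = ?U" if F: "Pow_product_proper_filter I X F" "?U \<subseteq> F" for F
  proof (rule ccontr)
    have "F \<subseteq> Pow_product I X"
      and Int: "\<And>Y Z. Y \<in> F \<Longrightarrow> Z \<in> F \<Longrightarrow> (\<lambda>i\<in>I. Y i \<inter> Z i) \<in> F"
      and up: "\<And>Y Z. Y \<in> F \<Longrightarrow> Z \<in> Pow_product I X \<Longrightarrow> \<forall>i\<in>I. Y i \<subseteq> Z i \<Longrightarrow> Z \<in> F"
      using F(1) by (auto simp: Pow_product_proper_filter_def Pow_product_filter_def)
    assume "F \<noteq> ?U"
    then obtain Y where Y: "Y \<in> F" "Y j \<notin> W" "Y \<in> Pow_product I X"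
      using F(2) \<open>F \<subseteq> Pow_product I X\<close> by blast
    \<comment> \<open>\<open>Y\<close> and \<open>?Z\<close> meet in the bottom family: by
      complementation at \<open>j\<close>, by emptiness of \<open>?Z\<close> elsewhere. Bottom in
      \<open>F\<close> makes \<open>F\<close> improper.\<close>
    let ?Z = "\<lambda>i\<in>I. if i = j then X j - Y j else {}"
    have "X j - Y j \<in> W"
      using Y \<open>j \<in> I\<close> W.Diff_mem_iff by (auto simp: Pow_product_iff)
    then have "(\<lambda>i\<in>I. Y i \<inter> ?Z i) \<in> F"
      using in_U F(2) Int[OF Y(1)] by blast
    from up[OF this] have "V \<in> F" if "V \<in> Pow_product I X" for V
      using that by auto
    then have "Pow_product I X \<subseteq> F"
      by blast
    then show False
      using F(1) \<open>F \<subseteq> Pow_product I X\<close> by (auto simp: Pow_product_proper_filter_def)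
  qed
  ultimately show ?thesis
    by (auto simp: Pow_product_ultrafilter_def)
qed

text \<open>The filter \<open>F\<close> generated by \<open>U\<close> and \<open>Y\<close> exceeds
  \<open>U\<close>, so it is improper and contains bottom. This yields \<open>A \<in> U\<close>
  disjoint from \<open>Y\<close> in every coordinate, and the complement of \<open>Y\<close> lies
  above \<open>A\<close>.\<close>

lemma Pow_product_ultrafilter_compl_mem:
  assumes U: "Pow_product_ultrafilter I X U" and Y: "Y \<in> Pow_product I X" "Y \<notin> U"
  shows "(\<lambda>i\<in>I. X i - Y i) \<in> U"
proof -
  have U_sub: "U \<subseteq> Pow_product I X" and U_ne: "U \<noteq> {}"
    and Int: "\<And>Y Z. Y \<in> U \<Longrightarrow> Z \<in> U \<Longrightarrow> (\<lambda>i\<in>I. Y i \<inter> Z i) \<in> U"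
    and up: "\<And>Y Z. Y \<in> U \<Longrightarrow> Z \<in> Pow_product I X \<Longrightarrow> (\<And>i. i \<in> I \<Longrightarrow> Y i \<subseteq> Z i) \<Longrightarrow> Z \<in> U"
    and max: "\<And>F. Pow_product_proper_filter I X F \<Longrightarrow> U \<subseteq> F \<Longrightarrow> F = U"
    using U
    by (auto simp: Pow_product_ultrafilter_def Pow_product_proper_filter_def Pow_product_filter_def)
  define F where "F = {Z \<in> Pow_product I X. \<exists>A\<in>U. \<forall>i\<in>I. A i \<inter> Y i \<subseteq> Z i}"
  have "Y \<in> F" "U \<subseteq> F"
    using Y U_ne U_sub by (auto simp: F_def)
  have "Pow_product_filter I X F"
    unfolding Pow_product_filter_def
  proof (intro conjI ballI impI)
    show "F \<subseteq> Pow_product I X" "F \<noteq> {}"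
      using \<open>Y \<in> F\<close> by (auto simp: F_def)
    fix Z Z' assume Z: "Z \<in> F"
    show "(\<lambda>i\<in>I. Z i \<inter> Z' i) \<in> F" if "Z' \<in> F"
    proof -
      obtain A A' where "A \<in> U" "A' \<in> U" "\<forall>i\<in>I. A i \<inter> Y i \<subseteq> Z i" "\<forall>i\<in>I. A' i \<inter> Y i \<subseteq> Z' i"
        using Z \<open>Z' \<in> F\<close> by (auto simp: F_def)
      then show ?thesis
        using Int[of A A'] Z \<open>Z' \<in> F\<close> unfolding F_def
        by (intro CollectI conjI bexI[of _ "\<lambda>i\<in>I. A i \<inter> A' i"]) (auto simp: Pow_product_iff)
    qed
    show "Z' \<in> F" if "Z' \<in> Pow_product I X" "\<forall>i\<in>I. Z i \<subseteq> Z' i"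
      using Z that unfolding F_def by blast
  qed
  then have "F = Pow_product I X"
    using max[of F] \<open>U \<subseteq> F\<close> \<open>Y \<in> F\<close> Y(2) by (auto simp: Pow_product_proper_filter_def)
  moreover have "(\<lambda>i\<in>I. {}) \<in> Pow_product I X"
    by (auto simp: Pow_product_iff)
  ultimately have "(\<lambda>i\<in>I. {}) \<in> F"
    by simp
  then obtain A where A: "A \<in> U" "\<forall>i\<in>I. A i \<inter> Y i = {}"
    by (auto simp: F_def)
  show ?thesis
  proof (rule up[OF A(1)])
    show "(\<lambda>i\<in>I. X i - Y i) \<in> Pow_product I X"
      by (auto simp: Pow_product_iff)
    show "A i \<subseteq> (\<lambda>i\<in>I. X i - Y i) i" if "i \<in> I" for i
      using that A U_sub by (fastforce simp: Pow_product_iff)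
  qed
qed

section \<open>Ideals of the product ring\<close>

lemma product_ring_simps:
  "carrier (product_ring I D) = (\<Pi>\<^sub>E i\<in>I. carrier (D i))"
  "x \<otimes>\<^bsub>product_ring I D\<^esub> y = (\<lambda>i\<in>I. x i \<otimes>\<^bsub>D i\<^esub> y i)"
  "x \<oplus>\<^bsub>product_ring I D\<^esub> y = (\<lambda>i\<in>I. x i \<oplus>\<^bsub>D i\<^esub> y i)"
  "\<one>\<^bsub>product_ring I D\<^esub> = (\<lambda>i\<in>I. \<one>\<^bsub>D i\<^esub>)"
  "\<zero>\<^bsub>product_ring I D\<^esub> = (\<lambda>i\<in>I. \<zero>\<^bsub>D i\<^esub>)"
  by (simp_all add: product_ring_def)

lemma vanishing_family_mem_Pow_product:
  "vanishing_family I D a \<in> Pow_product I (\<lambda>i. max_spectrum (D i))"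
  by (auto simp: vanishing_family_def Pow_product_def max_vanish_def)

text \<open>\<open>?K\<close> is the preimage of the limit under the projection to
  \<open>D j\<close>. Ideals above the limit pull back to ideals above \<open>?K\<close>, and
  surjectivity of the projection brings maximality down.\<close>

lemma maximalideal_ultrafilter_limit_if_filter_ideal:
  fixes D :: "'i \<Rightarrow> ('a, 'm) ring_scheme"
  assumes D: "\<And>i. i \<in> I \<Longrightarrow> cring (D i)" and j: "j \<in> I"
    and W: "ultrafilter_on (max_spectrum (D j)) W"
    and max: "maximalideal (filter_ideal I D
      {Y \<in> Pow_product I (\<lambda>i. max_spectrum (D i)). Y j \<in> W}) (product_ring I D)"
      (is "maximalideal ?K _")
  shows "maximalideal (ultrafilter_limit (D j) (max_spectrum (D j)) W) (D j)"
proof -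
  let ?L = "ultrafilter_limit (D j) (max_spectrum (D j)) W"
  interpret Dj: cring "D j"
    using D j .
  interpret R: cring "product_ring I D"
    by (rule cring_product_ring[OF D])
  interpret K: maximalideal ?K "product_ring I D"
    by (rule max)
  have K: "a \<in> ?K \<longleftrightarrow> a j \<in> ?L" if "a \<in> carrier (product_ring I D)" for a
  proof -
    have "a j \<in> carrier (D j)"
      using that j by (auto simp: product_ring_simps)
    moreover have "vanishing_family I D a j = {M \<in> max_spectrum (D j). a j \<in> M}"
      using j by (simp add: vanishing_family_def max_vanish_def)
    ultimately show ?thesis
      using that vanishing_family_mem_Pow_product[of I D a]
      unfolding filter_ideal_def ultrafilter_limit_def mem_Collect_eq by metis
  qed
  have "primeideal ?L (D j)"
    using Dj.ultrafilter_limit_mem_prime_spectrum[OF Dj.max_spectrum_subset_prime_spectrum W]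
    by (simp add: prime_spectrum_def)
  then interpret L: primeideal ?L "D j" .
  show ?thesis
  proof (rule maximalidealI)
    show "ideal ?L (D j)" "carrier (D j) \<noteq> ?L"
      by (rule L.is_ideal, rule L.I_notcarr)
    fix J assume J: "ideal J (D j)" "?L \<subseteq> J" "J \<subseteq> carrier (D j)"
    interpret J: ideal J "D j" by fact
    define J' where "J' = {a \<in> carrier (product_ring I D). a j \<in> J}"
    have J': "a \<in> J' \<longleftrightarrow> a \<in> carrier (product_ring I D) \<and> a j \<in> J" for a
      by (simp add: J'_def)
    have "ideal J' (product_ring I D)"
    proof (rule R.idealI')
      show "\<zero>\<^bsub>product_ring I D\<^esub> \<in> J'"
        using j R.zero_closed by (simp add: J' product_ring_simps(5))
      show "x \<oplus>\<^bsub>product_ring I D\<^esub> y \<in> J'" if "x \<in> J'" "y \<in> J'" for x y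
      proof -
        have "(x \<oplus>\<^bsub>product_ring I D\<^esub> y) j = x j \<oplus>\<^bsub>D j\<^esub> y j"
          using j by (simp add: product_ring_simps(3))
        then show ?thesis
          using that R.add.m_closed J.a_closed by (simp add: J')
      qed
      show "r \<otimes>\<^bsub>product_ring I D\<^esub> x \<in> J'" if "x \<in> J'" "r \<in> carrier (product_ring I D)" for x r
      proof -
        have "(r \<otimes>\<^bsub>product_ring I D\<^esub> x) j = r j \<otimes>\<^bsub>D j\<^esub> x j"
          using j by (simp add: product_ring_simps(2))
        moreover have "r j \<in> carrier (D j)"
          using that(2) j by (auto simp: product_ring_simps(1))
        ultimately show ?thesis
          using that R.m_closed J.I_l_closed by (simp add: J')
      qed
    qed (simp add: J'_def)
    moreover have "?K \<subseteq> J'"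
    proof
      fix a assume "a \<in> ?K"
      then show "a \<in> J'"
        using K[OF K.Icarr] K.Icarr J(2) unfolding J' by blast
    qed
    moreover have "J' \<subseteq> carrier (product_ring I D)"
      by (auto simp: J'_def)
    ultimately consider "J' = ?K" | "J' = carrier (product_ring I D)"
      using K.I_maximal by blast
    then show "J = ?L \<or> J = carrier (D j)"
    proof cases
      case 1
      have "x \<in> ?L" if "x \<in> J" for x
      proof -
        \<comment> \<open>A lift of \<open>x\<close> along the projection, zero in the other
          coordinates.\<close>
        let ?a = "\<lambda>i\<in>I. if i = j then x else \<zero>\<^bsub>D i\<^esub>"
        have "?a \<in> carrier (product_ring I D)"
          using that J.Icarr cring.cring_simprules(2)[OF D] by (auto simp: product_ring_simps(1))
        moreover from this have "?a \<in> ?K"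
          using J'[of ?a] 1 that j by simp
        ultimately show ?thesis
          using K[of ?a] j by simp
      qed
      then show ?thesis
        using J(2) by blast
    next
      case 2
      then have "\<one>\<^bsub>product_ring I D\<^esub> \<in> J'"
        using R.one_closed by blast
      then have "\<one>\<^bsub>D j\<^esub> \<in> J"
        using j by (simp add: J' product_ring_simps(4))
      then show ?thesis
        using J.one_imp_carrier by blast
    qed
  qed
qed

text \<open>That \<open>?K\<close> is an ideal reflects S(x) \<and> S(y) \<le> S(x + y) and S(x)
  \<le> S(r x). For maximality, an ideal containing \<open>?K\<close> and some \<open>a\<close>
  outside it is shown to contain the unit element.\<close>

lemma maximalideal_filter_ideal:
  fixes D :: "'i \<Rightarrow> ('a, 'm) ring_scheme"
  assumes D: "\<And>i. i \<in> I \<Longrightarrow> cring (D i)"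
    and compl: "\<And>i r. i \<in> I \<Longrightarrow> r \<in> carrier (D i) \<Longrightarrow>
      \<exists>d\<in>carrier (D i). max_nonvanish (D i) r = max_vanish (D i) d"
    and U: "Pow_product_ultrafilter I (\<lambda>i. max_spectrum (D i)) U"
  shows "maximalideal (filter_ideal I D U) (product_ring I D)" (is "maximalideal ?K ?R")
proof -
  interpret R: cring ?R
    by (rule cring_product_ring[OF D])
  let ?B = "Pow_product I (\<lambda>i. max_spectrum (D i))"
  let ?S = "vanishing_family I D"
  have U_sub: "U \<subseteq> ?B" and U_ne: "U \<noteq> {}" and U_proper: "U \<noteq> ?B"
    and Int: "\<And>Y Z. Y \<in> U \<Longrightarrow> Z \<in> U \<Longrightarrow> (\<lambda>i\<in>I. Y i \<inter> Z i) \<in> U"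
    and up: "\<And>Y Z. Y \<in> U \<Longrightarrow> Z \<in> ?B \<Longrightarrow> (\<And>i. i \<in> I \<Longrightarrow> Y i \<subseteq> Z i) \<Longrightarrow> Z \<in> U"
    using U by (auto simp: Pow_product_ultrafilter_def Pow_product_proper_filter_def Pow_product_filter_def)
  have K: "a \<in> ?K \<longleftrightarrow> a \<in> carrier ?R \<and> ?S a \<in> U" for a
    by (simp add: filter_ideal_def)
  have S: "?S a \<in> ?B" for a
    by (rule vanishing_family_mem_Pow_product)
  have mem: "a i \<in> carrier (D i)" if "a \<in> carrier ?R" "i \<in> I" for a i
    using that by (auto simp: product_ring_simps(1))
  have one: "\<one>\<^bsub>?R\<^esub> \<notin> ?K"
  proof
    assume "\<one>\<^bsub>?R\<^esub> \<in> ?K"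
    then have 1: "?S \<one>\<^bsub>?R\<^esub> \<in> U"
      by (simp add: K)
    have "?S \<one>\<^bsub>?R\<^esub> i = {}" if "i \<in> I" for i
      using that cring.max_spectrumD(2)[OF D[OF that]]
      by (auto simp: vanishing_family_def max_vanish_def product_ring_simps(4))
    then have "?B \<subseteq> U"
      using up[OF 1] by (metis empty_subsetI subsetI)
    then show False
      using U_sub U_proper by blast
  qed
  have ideal: "ideal ?K ?R"
  proof (rule R.idealI')
    show "?K \<subseteq> carrier ?R"
      by (auto simp: K)
    obtain Y where "Y \<in> U"
      using U_ne by blast
    moreover have "Y i \<subseteq> ?S \<zero>\<^bsub>?R\<^esub> i" if "i \<in> I" for i
      using that \<open>Y \<in> U\<close> U_sub cring.max_spectrumD(1)[OF D[OF that]]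
      by (fastforce simp: vanishing_family_def max_vanish_def product_ring_simps(5) Pow_product_def)
    ultimately show "\<zero>\<^bsub>?R\<^esub> \<in> ?K"
      using up S R.zero_closed by (auto simp: K)
  next
    fix x y assume xy: "x \<in> ?K" "y \<in> ?K"
    have "(\<lambda>i\<in>I. ?S x i \<inter> ?S y i) \<in> U"
      using xy Int by (auto simp: K)
    moreover have "(\<lambda>i\<in>I. ?S x i \<inter> ?S y i) i \<subseteq> ?S (x \<oplus>\<^bsub>?R\<^esub> y) i" if "i \<in> I" for i
      using that cring.max_spectrumD(3)[OF D[OF that]]
      by (auto simp: vanishing_family_def max_vanish_def product_ring_simps(3))
    ultimately show "x \<oplus>\<^bsub>?R\<^esub> y \<in> ?K"
      using up[OF _ S] xy R.add.m_closed by (auto simp: K)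
  next
    fix x r assume xr: "x \<in> ?K" "r \<in> carrier ?R"
    then have x: "x \<in> carrier ?R" "?S x \<in> U"
      by (auto simp: K)
    have "?S x i \<subseteq> ?S (r \<otimes>\<^bsub>?R\<^esub> x) i" if "i \<in> I" for i
      using that cring.max_spectrumD(4)[OF D[OF that]] mem[OF x(1) that] mem[OF xr(2) that]
      by (auto simp: vanishing_family_def max_vanish_def product_ring_simps(2))
    then show "r \<otimes>\<^bsub>?R\<^esub> x \<in> ?K"
      using up[OF x(2) S] xr x R.m_closed by (auto simp: K)
  qed
  show ?thesis
  proof (rule maximalidealI[OF ideal])
    show "carrier ?R \<noteq> ?K"
      using one R.one_closed by blast
    fix J assume J: "ideal J ?R" "?K \<subseteq> J" "J \<subseteq> carrier ?R"
    interpret J: ideal J ?R by fact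
    show "J = ?K \<or> J = carrier ?R"
    proof (rule disjCI)
      assume "J \<noteq> carrier ?R"
      show "J = ?K"
      proof (rule ccontr)
        assume "J \<noteq> ?K"
        then obtain a where a: "a \<in> J" "a \<notin> ?K"
          using J(2) by blast
        then have aR: "a \<in> carrier ?R" and "?S a \<notin> U"
          using J(3) by (auto simp: K)
        \<comment> \<open>The \<open>d\<close> provided by \<open>compl\<close> shares no maximal
          ideal with \<open>a i\<close>. Comaximality only yields a multiple \<open>y\<close> of it,
          whose vanishing set may be larger, so an inclusion replaces the equality; upward closure
          of \<open>U\<close> absorbs this.\<close>
        have "\<exists>x d. x \<in> carrier (D i) \<and> d \<in> carrier (D i) \<and>
            max_nonvanish (D i) (a i) \<subseteq> max_vanish (D i) d \<and> \<one>\<^bsub>D i\<^esub> = x \<otimes>\<^bsub>D i\<^esub> a i \<oplus>\<^bsub>D i\<^esub> d"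
          if i: "i \<in> I" for i
        proof -
          interpret Di: cring "D i"
            using D i .
          obtain d where d: "d \<in> carrier (D i)" "max_nonvanish (D i) (a i) = max_vanish (D i) d"
            using compl[OF i mem[OF aR i]] by blast
          have "\<not> PIdl\<^bsub>D i\<^esub> d \<subseteq> M" if "M \<in> max_spectrum (D i)" "a i \<in> M" for M
            using Di.cgenideal_self[OF d(1)] d(2) that
            by (auto simp: max_nonvanish_def max_vanish_def)
          from Di.comaximal[OF Di.cgenideal_ideal[OF d(1)] mem[OF aR i] this]
          obtain x y where xy: "x \<in> carrier (D i)" "y \<in> PIdl\<^bsub>D i\<^esub> d"
            "\<one>\<^bsub>D i\<^esub> = x \<otimes>\<^bsub>D i\<^esub> a i \<oplus>\<^bsub>D i\<^esub> y"
            by metis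
          have "y \<in> carrier (D i)"
            using ideal.Icarr[OF Di.cgenideal_ideal[OF d(1)] xy(2)] .
          moreover have "max_vanish (D i) d \<subseteq> max_vanish (D i) y"
            using xy(2) Di.max_spectrumD(4) d(1) by (auto simp: max_vanish_def cgenideal_def)
          ultimately show ?thesis
            using xy d(2) by blast
        qed
        then obtain x d where xd: "\<And>i. i \<in> I \<Longrightarrow> x i \<in> carrier (D i)"
          "\<And>i. i \<in> I \<Longrightarrow> d i \<in> carrier (D i)"
          "\<And>i. i \<in> I \<Longrightarrow> max_nonvanish (D i) (a i) \<subseteq> max_vanish (D i) (d i)"
          "\<And>i. i \<in> I \<Longrightarrow> \<one>\<^bsub>D i\<^esub> = x i \<otimes>\<^bsub>D i\<^esub> a i \<oplus>\<^bsub>D i\<^esub> d i"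
          by metis
        let ?x = "restrict x I" and ?d = "restrict d I"
        \<comment> \<open>The complement of S(a) is in \<open>U\<close> and \<open>?d\<close>
          vanishes on it, so \<open>?d\<close> lies in \<open>?K \<subseteq> J\<close>; with
          \<open>a \<in> J\<close> this puts the unit element into \<open>J\<close>.\<close>
        have "(\<lambda>i\<in>I. max_spectrum (D i) - ?S a i) \<in> U"
          by (rule Pow_product_ultrafilter_compl_mem[OF U S \<open>?S a \<notin> U\<close>])
        moreover have "(\<lambda>i\<in>I. max_spectrum (D i) - ?S a i) i \<subseteq> ?S ?d i" if "i \<in> I" for i
          using xd(3)[OF that] that by (simp add: max_nonvanish_def vanishing_family_def)
        ultimately have "?S ?d \<in> U"
          by (rule up[OF _ S])
        moreover have "?x \<in> carrier ?R" "?d \<in> carrier ?R"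
          using xd(1,2) by (auto simp: product_ring_simps(1))
        ultimately have "?x \<otimes>\<^bsub>?R\<^esub> a \<oplus>\<^bsub>?R\<^esub> ?d \<in> J"
          using J.I_l_closed[OF a(1)] J(2) J.a_closed by (auto simp: K)
        moreover have "?x \<otimes>\<^bsub>?R\<^esub> a \<oplus>\<^bsub>?R\<^esub> ?d = \<one>\<^bsub>?R\<^esub>"
          using xd(4) by (auto simp: product_ring_simps(2-4))
        ultimately show False
          using J.one_imp_carrier \<open>J \<noteq> carrier ?R\<close> by simp
      qed
    qed
  qed
qed

theorem corollary2p23:
  fixes I :: "'i set" and D :: "'i \<Rightarrow> ('a, 'm) ring_scheme"
  assumes "\<And>i. i \<in> I \<Longrightarrow> cring (D i)"
  shows "((\<forall>U. Pow_product_ultrafilter I (\<lambda>i. max_spectrum (D i)) U \<longrightarrow>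
              maximalideal (filter_ideal I D U) (product_ring I D))
          \<longleftrightarrow> (\<forall>i\<in>I. proconstructible (D i) (max_spectrum (D i))))
       \<and> ((\<forall>i\<in>I. proconstructible (D i) (max_spectrum (D i)))
          \<longleftrightarrow> (\<forall>i\<in>I. \<forall>r\<in>carrier (D i). \<exists>d\<in>carrier (D i).
                 max_nonvanish (D i) r = max_vanish (D i) d))"
    (is "(?a \<longleftrightarrow> ?b) \<and> (?b \<longleftrightarrow> ?c)")
proof -
  \<comment> \<open>The equivalences follow from (a) to (c), (b) to (c), (c) to (a) and (c) to (b);
    the first two share this step.\<close>
  have limits_c: "\<exists>d\<in>carrier (D i). max_nonvanish (D i) r = max_vanish (D i) d"
    if "i \<in> I" "r \<in> carrier (D i)"
      and "\<And>W. ultrafilter_on (max_spectrum (D i)) W \<Longrightarrow>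
        maximalideal (ultrafilter_limit (D i) (max_spectrum (D i)) W) (D i)" for i r
    using cring.max_nonvanish_eq_max_vanish_if_ultrafilter_limits_maximal[OF assms[OF that(1)] that(3,2)]
    by blast
  have "?c" if "?a"
  proof (intro ballI)
    fix i r assume ir: "i \<in> I" "r \<in> carrier (D i)"
    show "\<exists>d\<in>carrier (D i). max_nonvanish (D i) r = max_vanish (D i) d"
    proof (rule limits_c[OF ir])
      fix W assume W: "ultrafilter_on (max_spectrum (D i)) W"
      show "maximalideal (ultrafilter_limit (D i) (max_spectrum (D i)) W) (D i)"
      proof (rule maximalideal_ultrafilter_limit_if_filter_ideal[where I = I])
        \<comment> \<open>Here (a) is applied to the ultrafilter of the product that is pulled back
          from \<open>W\<close> at coordinate \<open>i\<close>.\<close>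
        show "maximalideal (filter_ideal I D
            {Y \<in> Pow_product I (\<lambda>i. max_spectrum (D i)). Y i \<in> W}) (product_ring I D)"
          using \<open>?a\<close> Pow_product_ultrafilter_pullback[where X = "\<lambda>i. max_spectrum (D i)", OF ir(1) W]
          by blast
      qed (use assms ir(1) W in auto)
    qed
  qed
  moreover have "?c" if "?b"
  proof (intro ballI)
    fix i r assume ir: "i \<in> I" "r \<in> carrier (D i)"
    show "\<exists>d\<in>carrier (D i). max_nonvanish (D i) r = max_vanish (D i) d"
    proof (rule limits_c[OF ir])
      fix W assume "ultrafilter_on (max_spectrum (D i)) W"
      then have "ultrafilter_limit (D i) (max_spectrum (D i)) W \<in> max_spectrum (D i)"
        using cring.ultrafilter_limit_mem_proconstructible[OF assms[OF ir(1)]] \<open>?b\<close> ir(1) by blast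
      then show "maximalideal (ultrafilter_limit (D i) (max_spectrum (D i)) W) (D i)"
        by (simp add: max_spectrum_def)
    qed
  qed
  moreover have "?a" if "?c"
  proof (intro allI impI)
    fix U assume U: "Pow_product_ultrafilter I (\<lambda>i. max_spectrum (D i)) U"
    show "maximalideal (filter_ideal I D U) (product_ring I D)"
      by (rule maximalideal_filter_ideal[OF assms _ U]) (use \<open>?c\<close> in simp_all)
  qed
  moreover have "?b" if "?c"
    using \<open>?c\<close> by (intro ballI cring.proconstructible_max_spectrum[OF assms]) simp_all
  ultimately show ?thesis
    by blast
qed

end
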